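(* The family $(F^{(\lambda)})_{|\lambda|>1}$ (indexed by $\lambda\in\mathbb C$ with $|\lambda|>1$) of preduals of $\ell_1(\mathbb Z)$ induces a continuum of distinct weak$^*$-topologies on $\ell_1(\mathbb Z)$, each of which makes the (convolution) multiplication of $\ell_1(\mathbb Z)$ separately weak$^*$-continuous. Each of these topologies is distinct from the weak$^*$-topology induced by the canonical pairing of $c_0(\mathbb Z)$ with $\ell_1(\mathbb Z)$.
   Context: Scalars are complex. Write $\langle x,a\rangle=\sum_{n}x(n)a(n)$ for $x\in\ell_\infty(\mathbb Z)$, $a\in\ell_1(\mathbb Z)$. A closed subspace $F\subseteq\ell_\infty(\mathbb Z)$ is a concrete predual of $\ell_1(\mathbb Z)$ if $\iota_F:\ell_1(\mathbb Z)\to F^*$, $\iota_F(a)(x)=\langle x,a\rangle$, is an isomorphism of Banach spaces (not necessarily isometric). The weak$^*$-topology on $\ell_1(\mathbb Z)$ induced by $F$ is the coarsest topology making $a\mapsto\langle x,a\rangle$ continuous for every $x\in F$. Multiplication on $\ell_1(\mathbb Z)$ is convolution, $(f*g)(n)=\sum_k f(k)g(n-k)$. For $n\ge 0$ let $b(n)$ be the number of ones in the binary expansion of $n$. For $\lambda\in\mathbb C$, $|\lambda|>1$, define $x_0^{(\lambda)}\in\ell_\infty(\mathbb Z)$ by $x_0^{(\lambda)}(n)=\lambda^{-b(n)}$ for $n\ge0$ and $x_0^{(\lambda)}(n)=0$ for $n<0$. With $\sigma(x)(n)=x(n-1)$ the bilateral shift, $F^{(\lambda)}$ is the closed linear span in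 $\ell_\infty(\mathbb Z)$ of $\{\sigma^m(x_0^{(\lambda)}):m\in\mathbb Z\}$; each $F^{(\lambda)}$ is a concrete predual of $\ell_1(\mathbb Z)$. *)

theory Defs
  imports "HOL-Analysis.Analysis"
begin

text \<open>
  The space \<open>\<ell>\<^sub>\<infinity>(\<int>)\<close> is the type of bounded continuous functions on \<open>\<int>\<close>: the library topology on
  \<^typ>\<open>int\<close> is discrete, so continuity is no restriction, and the library norm is the supremum norm.
\<close>

unbundle bcontfun.lifting

type_synonym linf = "int \<Rightarrow>\<^sub>C complex"

lemma bcontfun_int_iff: "(f :: int \<Rightarrow> complex) \<in> bcontfun \<longleftrightarrow> bounded (range f)"
  by (simp add: bcontfun_def)

text \<open>The library only provides real scalars on \<^typ>\<open>linf\<close>; linear spans below are over \<open>\<complex>\<close>.\<close>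

lift_definition scaleC_linf :: "complex \<Rightarrow> linf \<Rightarrow> linf" is "\<lambda>c x n. c * x n"
proof -
  fix c :: complex and x :: "int \<Rightarrow> complex"
  assume "x \<in> bcontfun"
  then obtain B where B: "norm (x n) \<le> B" for n
    by (auto simp: bcontfun_int_iff bounded_iff)
  have "norm (c * x n) \<le> norm c * B" for n
    unfolding norm_mult by (rule mult_left_mono[OF B norm_ge_zero])
  then show "(\<lambda>n. c * x n) \<in> bcontfun"
    unfolding bcontfun_int_iff bounded_iff by auto
qed

interpretation linf: vector_space scaleC_linf
  by unfold_locales (transfer; simp add: algebra_simps)+

text \<open>\<open>shift_linf m\<close> is the \<open>m\<close>-th power, \<open>m \<in> \<int>\<close>, of the bilateral shift \<open>\<sigma>(x)(n) = x(n - 1)\<close>.\<close>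

lift_definition shift_linf :: "int \<Rightarrow> linf \<Rightarrow> linf" is "\<lambda>m x n. x (n - m)"
  unfolding bcontfun_int_iff by (erule bounded_subset) auto

definition c0 :: "linf set" where
  "c0 = {x. (apply_bcontfun x \<longlongrightarrow> 0) cofinite}"

definition ell1 :: "(int \<Rightarrow> complex) set" where
  "ell1 = {a. (\<lambda>n. norm (a n)) summable_on UNIV}"

definition pairing :: "linf \<Rightarrow> (int \<Rightarrow> complex) \<Rightarrow> complex" where
  "pairing x a = (\<Sum>\<^sub>\<infinity>n. apply_bcontfun x n * a n)"

definition convolution :: "(int \<Rightarrow> complex) \<Rightarrow> (int \<Rightarrow> complex) \<Rightarrow> int \<Rightarrow> complex" where
  "convolution f g = (\<lambda>n. \<Sum>\<^sub>\<infinity>k. f k * g (n - k))"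

definition weak_star_topology :: "linf set \<Rightarrow> (int \<Rightarrow> complex) topology" where
  "weak_star_topology F =
     topology_generated_by {{a \<in> ell1. pairing x a \<in> U} | x U. x \<in> F \<and> open U}"

text \<open>For nonempty \<open>F\<close> this is the coarsest topology on \<open>\<ell>\<^sub>1(\<int>)\<close> making all pairings with
  elements of \<open>F\<close> continuous.\<close>

lemma topspace_weak_star_topology:
  assumes "F \<noteq> {}"
  shows "topspace (weak_star_topology F) = ell1"
proof -
  from assms obtain x where "x \<in> F" by blast
  then have "ell1 \<in> {{a \<in> ell1. pairing x a \<in> U} | x U. x \<in> F \<and> open U}"
    by (auto intro!: exI[of _ x] exI[of _ UNIV])
  then show ?thesis
    unfolding weak_star_topology_def topology_generated_by_topspace by blast
qed

lemma continuous_map_weak_star_topology: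
  assumes "x \<in> F"
  shows "continuous_map (weak_star_topology F) euclidean (pairing x)"
proof -
  have "topspace (weak_star_topology F) = ell1"
    using assms by (intro topspace_weak_star_topology) auto
  moreover have "openin (weak_star_topology F) {a \<in> ell1. pairing x a \<in> U}" if "open U" for U
    unfolding weak_star_topology_def using assms that
    by (intro topology_generated_by_Basis) blast
  ultimately show ?thesis
    by (simp add: continuous_map_def)
qed

lemma weak_star_topology_coarsest:
  assumes "topspace T = ell1" and "\<And>x. x \<in> F \<Longrightarrow> continuous_map T euclidean (pairing x)"
    and "openin (weak_star_topology F) S"
  shows "openin T S"
proof -
  have basis: "openin T {a \<in> ell1. pairing x a \<in> U}" if "x \<in> F" "open U" for x U
    using assms(1) assms(2)[OF that(1)] that(2) by (auto simp: continuous_map_def)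
  have gen: "generate_topology_on {{a \<in> ell1. pairing x a \<in> U} | x U. x \<in> F \<and> open U} S"
    using assms(3) by (simp add: weak_star_topology_def openin_topology_generated_by_iff)
  show ?thesis
    by (rule generate_topology_on_coarsest[OF istopology_openin _ gen]) (use basis in blast)
qed

definition separately_continuous_convolution :: "(int \<Rightarrow> complex) topology \<Rightarrow> bool" where
  "separately_continuous_convolution T \<longleftrightarrow>
     (\<forall>a\<in>ell1. continuous_map T T (\<lambda>b. convolution a b) \<and> continuous_map T T (\<lambda>b. convolution b a))"

definition binary_ones :: "nat \<Rightarrow> nat" where
  "binary_ones n = card {i. bit n i}"

definition x0 :: "complex \<Rightarrow> linf" where
  "x0 l = Bcontfun (\<lambda>n. if n \<ge> 0 then l powi (- int (binary_ones (nat n))) else 0)"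

text \<open>The abstraction \<^const>\<open>Bcontfun\<close> is meaningful for the parameters of interest.\<close>

lemma apply_x0:
  assumes "norm l > 1"
  shows "apply_bcontfun (x0 l) n = (if n \<ge> 0 then l powi (- int (binary_ones (nat n))) else 0)"
proof -
  have "norm (l powi (- int k)) \<le> 1" for k
    using assms one_le_power[of "norm l" k]
    by (simp add: power_int_minus norm_inverse norm_power inverse_le_1_iff)
  then have "bounded (range (\<lambda>n. if n \<ge> 0 then l powi (- int (binary_ones (nat n))) else 0))"
    by (auto simp: bounded_iff intro!: exI[of _ 1])
  then show ?thesis
    unfolding x0_def by (subst Bcontfun_inverse) (simp_all add: bcontfun_int_iff)
qed

definition F_predual :: "complex \<Rightarrow> linf set" where
  "F_predual l = closure (linf.span (range (\<lambda>m. shift_linf m (x0 l))))"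

end

theory Submission
  imports Defs
begin

text \<open>
  The sequence \<open>\<delta>\<^bsub>2^n\<^esub>\<close> converges to \<open>\<lambda>\<inverse>\<delta>\<^sub>0\<close> in the topology induced by \<open>F\<^sup>(\<^sup>\<lambda>\<^sup>)\<close>, but to \<open>0\<close> in the one
  induced by \<open>c\<^sub>0\<close>: since \<open>b(2\<^sup>n + k) = 1 + b(k)\<close> for \<open>k < 2\<^sup>n\<close> and \<open>b(2\<^sup>n - m) \<rightarrow> \<infinity>\<close> for \<open>m > 0\<close>, the
  pairings with the shifts of \<open>x\<^sub>0\<close> converge, and this passes to the closed linear span.  As
  \<open>x\<^sub>0(0) = 1\<close>, the topology determines \<open>\<lambda>\<close>.  For separate continuity,
  \<open>\<langle>x, a * b\<rangle> = \<langle>y, b\<rangle>\<close> with \<open>y = \<Sum>\<^sub>k a(k) \<sigma>\<^sup>-\<^sup>k(x)\<close>, a norm convergent series in any closed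
  shift-invariant subspace containing \<open>x\<close>.
\<close>

no_notation Infinite_Set_Sum.abs_summable_on (infix \<open>abs'_summable'_on\<close> 50)

section \<open>Shift-invariant closed subspaces\<close>

text \<open>The library requires a metric on the domain, which \<^typ>\<open>int\<close> does not carry.\<close>

instance bcontfun :: (topological_space, complete_space) complete_space
proof
  fix X :: "nat \<Rightarrow> 'a \<Rightarrow>\<^sub>C 'b"
  assume "Cauchy X"
  then have "uniformly_Cauchy_on UNIV (\<lambda>n. apply_bcontfun (X n))"
    unfolding Cauchy_def uniformly_Cauchy_on_def by (meson dist_fun_lt_imp_dist_val_lt)
  then obtain g where "uniform_limit UNIV X g sequentially"
    using Cauchy_uniformly_convergent uniformly_convergent_on_def by blast
  then show "convergent X"
    by (rule uniform_limit_bcontfunE[OF _ sequentially_bot]) (auto intro: convergentI)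
qed

instance bcontfun :: (topological_space, banach) banach ..

lemma bounded_linear_scaleC_linf: "bounded_linear (scaleC_linf c)"
proof (rule bounded_linear_intro)
  show "scaleC_linf c (x + y) = scaleC_linf c x + scaleC_linf c y" for x y
    by (rule linf.scale_right_distrib)
  show "scaleC_linf c (r *\<^sub>R x) = r *\<^sub>R scaleC_linf c x" for r x
    by (rule bcontfun_eqI) (simp add: scaleC_linf.rep_eq)
  show "norm (scaleC_linf c x) \<le> norm x * norm c" for x
    by (rule norm_bound)
      (simp add: scaleC_linf.rep_eq norm_mult mult.commute mult_left_mono norm_bounded)
qed

lemma norm_shift_linf_le: "norm (shift_linf m x) \<le> norm x"
  by (rule norm_bound) (simp add: shift_linf.rep_eq norm_bounded)

lemma shift_linf_add: "shift_linf m (x + y) = shift_linf m x + shift_linf m y"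
  by (rule bcontfun_eqI) (simp add: shift_linf.rep_eq)

lemma shift_linf_scaleC: "shift_linf m (scaleC_linf c x) = scaleC_linf c (shift_linf m x)"
  by (rule bcontfun_eqI) (simp add: shift_linf.rep_eq scaleC_linf.rep_eq)

lemma shift_linf_zero [simp]: "shift_linf m 0 = 0"
  by (rule bcontfun_eqI) (simp add: shift_linf.rep_eq)

lemma shift_linf_0 [simp]: "shift_linf 0 x = x"
  by (rule bcontfun_eqI) (simp add: shift_linf.rep_eq)

lemma shift_linf_shift_linf: "shift_linf m (shift_linf k x) = shift_linf (m + k) x"
  by (rule bcontfun_eqI) (simp add: shift_linf.rep_eq algebra_simps)

lemma bounded_linear_shift_linf: "bounded_linear (shift_linf m)"
proof (rule bounded_linear_intro)
  show "shift_linf m (r *\<^sub>R x) = r *\<^sub>R shift_linf m x" for r x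
    by (rule bcontfun_eqI) (simp add: shift_linf.rep_eq)
  show "norm (shift_linf m x) \<le> norm x * 1" for x
    by (simp add: norm_shift_linf_le)
qed (rule shift_linf_add)

text \<open>Addition is handled with approximating sequences, complex scaling through boundedness of
  \<open>scaleC_linf c\<close>.\<close>

lemma subspace_closure_linf:
  assumes "linf.subspace S"
  shows "linf.subspace (closure S)"
proof (rule linf.subspaceI)
  show "0 \<in> closure S"
    using linf.subspace_0[OF assms] closure_subset by blast
next
  fix x y assume "x \<in> closure S" "y \<in> closure S"
  then obtain f g where "\<And>n::nat. f n \<in> S" "f \<longlonglongrightarrow> x" "\<And>n::nat. g n \<in> S" "g \<longlonglongrightarrow> y"
    unfolding closure_sequential by blast
  then show "x + y \<in> closure S"
    unfolding closure_sequential
    by (intro exI[of _ "\<lambda>n. f n + g n"]) (auto intro: tendsto_add linf.subspace_add[OF assms])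
next
  fix c x assume "x \<in> closure S"
  then have "scaleC_linf c x \<in> closure (scaleC_linf c ` S)"
    using closure_bounded_linear_image_subset[OF bounded_linear_scaleC_linf] by blast
  also have "\<dots> \<subseteq> closure S"
    by (intro closure_mono) (auto intro: linf.subspace_scale[OF assms])
  finally show "scaleC_linf c x \<in> closure S" .
qed

lemma subspace_F_predual: "linf.subspace (F_predual l)"
  unfolding F_predual_def by (rule subspace_closure_linf[OF linf.subspace_span])

lemma closed_F_predual: "closed (F_predual l)"
  by (simp add: F_predual_def)

text \<open>A shift only permutes the generators, so it preserves their span; being bounded, it
  preserves the closure as well.\<close>

lemma shift_linf_F_predual:
  assumes "x \<in> F_predual l"
  shows "shift_linf m x \<in> F_predual l"
proof -
  let ?G = "range (\<lambda>m. shift_linf m (x0 l))"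
  have "shift_linf m y \<in> linf.span ?G" if "y \<in> linf.span ?G" for y
    using that
  proof (rule linf.span_induct)
    show "linf.subspace {y. shift_linf m y \<in> linf.span ?G}"
      by (rule linf.subspaceI)
        (auto simp: shift_linf_add shift_linf_scaleC
          intro: linf.span_zero linf.span_add linf.span_scale)
  qed (auto simp: shift_linf_shift_linf intro: linf.span_base)
  then have "shift_linf m ` linf.span ?G \<subseteq> linf.span ?G"
    by blast
  then show ?thesis
    using assms closure_bounded_linear_image_subset[OF bounded_linear_shift_linf, of m "linf.span ?G"]
      closure_mono unfolding F_predual_def by blast
qed

lemma x0_in_F_predual: "x0 l \<in> F_predual l"
proof -
  have "x0 l \<in> range (\<lambda>m. shift_linf m (x0 l))"
    by (rule range_eqI[of _ _ 0]) simp
  then show ?thesis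
    unfolding F_predual_def by (intro subsetD[OF closure_subset] linf.span_base)
qed


section \<open>Separate continuity of the convolution\<close>

lemma ell1_D: "a \<in> ell1 \<Longrightarrow> a abs_summable_on UNIV"
  by (simp add: ell1_def)

lemma abs_summable_on_tensor:
  fixes f :: "'a \<Rightarrow> 'c::real_normed_div_algebra" and g :: "'b \<Rightarrow> 'c"
  assumes "f abs_summable_on A" and "g abs_summable_on B"
  shows "(\<lambda>(x, y). f x * g y) abs_summable_on A \<times> B"
  unfolding Infinite_Sum.abs_summable_on_Sigma_iff
  using assms by (auto simp: norm_mult infsum_cmult_right' infsum_nonneg
      intro!: summable_on_cmult_right summable_on_cmult_left)

text \<open>This change of variables turns the product family \<open>b n * a k\<close> into the
  terms of the convolution.\<close>

lemma bij_shear: "bij_betw (\<lambda>(n, k). (n - k, k)) UNIV (UNIV :: (int \<times> int) set)"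
  by (rule bij_betw_byWitness[where f' = "\<lambda>(n, k). (n + k, k)"]) auto

lemma abs_summable_convolution_terms:
  assumes "a \<in> ell1" "b \<in> ell1"
  shows "(\<lambda>(n, k). a k * b (n - k)) abs_summable_on UNIV"
proof -
  have "(\<lambda>(n, k). b n * a k) abs_summable_on UNIV"
    using abs_summable_on_tensor[OF ell1_D[OF assms(2)] ell1_D[OF assms(1)]] by simp
  from summable_on_reindex_bij_betw[OF bij_shear, THEN iffD2, OF this] show ?thesis
    by (simp add: case_prod_unfold mult.commute)
qed

text \<open>Absolute summability over pairs gives summable row sums of norms, and these dominate the
  convolution.\<close>

lemma convolution_in_ell1:
  assumes "a \<in> ell1" "b \<in> ell1"
  shows "convolution a b \<in> ell1"
proof -
  have "(\<lambda>(n, k). a k * b (n - k)) abs_summable_on UNIV \<times> UNIV"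
    using abs_summable_convolution_terms[OF assms] by simp
  then have *: "(\<lambda>k. a k * b (n - k)) abs_summable_on UNIV"
    "(\<lambda>n. \<Sum>\<^sub>\<infinity>k. norm (a k * b (n - k))) abs_summable_on UNIV" for n
    unfolding Infinite_Sum.abs_summable_on_Sigma_iff by simp_all
  have "convolution a b abs_summable_on UNIV"
    using *(2)
  proof (rule Infinite_Sum.abs_summable_on_comparison_test)
    show "norm (convolution a b n) \<le> norm (\<Sum>\<^sub>\<infinity>k. norm (a k * b (n - k)))" for n
      unfolding convolution_def using norm_infsum_bound[OF *(1)] by (simp add: infsum_nonneg)
  qed
  then show ?thesis
    by (simp add: ell1_def)
qed

lemma convolution_commute: "convolution a b = convolution b a"
proof
  fix n
  have "bij_betw (\<lambda>k. n - k) UNIV (UNIV :: int set)"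
    by (rule bij_betw_byWitness[where f' = "\<lambda>k. n - k"]) auto
  from infsum_reindex_bij_betw[OF this, of "\<lambda>k. a k * b (n - k)"]
  show "convolution a b n = convolution b a n"
    by (simp add: convolution_def mult.commute)
qed

text \<open>The adjoint of convolution by \<open>a\<close> maps \<open>F\<close> into itself, which
  is the form in which weak-star continuity is used below.\<close>

lemma pairing_convolution:
  assumes "closed F" and "linf.subspace F" and "\<And>m y. y \<in> F \<Longrightarrow> shift_linf m y \<in> F"
    and a: "a \<in> ell1" and x: "x \<in> F"
  obtains y where "y \<in> F" and "\<And>b. b \<in> ell1 \<Longrightarrow> pairing x (convolution a b) = pairing y b"
proof
  let ?g = "\<lambda>k. scaleC_linf (a k) (shift_linf (- k) x)"
  have "(\<lambda>k. a k * of_real (norm x)) abs_summable_on UNIV"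
    using ell1_D[OF a] by (simp add: norm_mult summable_on_cmult_left)
  then have "?g abs_summable_on UNIV"
    by (rule Infinite_Sum.abs_summable_on_comparison_test)
      (auto simp: scaleC_linf.rep_eq shift_linf.rep_eq norm_mult
        intro!: norm_bound mult_left_mono norm_bounded)
  then have sum: "(?g has_sum infsum ?g UNIV) UNIV"
    by (rule has_sum_infsum[OF Infinite_Sum.abs_summable_summable])
  \<comment> \<open>The series is the limit of its finite partial sums, which lie in the subspace;
    closedness then puts the limit in \<open>F\<close>.\<close>
  have "sum ?g M \<in> F" for M
    using assms by (intro linf.subspace_sum linf.subspace_scale) auto
  then show "infsum ?g UNIV \<in> F"
    using sum \<open>closed F\<close> unfolding has_sum_def
    by (intro Lim_in_closed_set[of F "sum ?g"]) auto
  have y: "infsum ?g UNIV n = (\<Sum>\<^sub>\<infinity>k. a k * x (n + k))" for n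
  proof -
    \<comment> \<open>Evaluation at \<open>n\<close> is continuous, so the norm convergent series
      may be summed coordinatewise.\<close>
    have "bounded_linear (\<lambda>z::linf. z n)"
      by (rule bounded_linear_intro[where K = 1]) (auto simp: norm_bounded)
    from has_sum_bounded_linear[OF this sum] show ?thesis
      by (intro infsumI[symmetric]) (simp add: scaleC_linf.rep_eq shift_linf.rep_eq o_def)
  qed
  fix b assume b: "b \<in> ell1"
  let ?h = "\<lambda>n k. x n * (a k * b (n - k))"
  have "(\<lambda>(n, k). of_real (norm x) * (a k * b (n - k))) abs_summable_on UNIV"
    using summable_on_cmult_right[OF abs_summable_convolution_terms[OF a b], of "norm x"]
    by (simp add: case_prod_unfold norm_mult)
  then have "(\<lambda>(n, k). ?h n k) abs_summable_on UNIV"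
    by (rule Infinite_Sum.abs_summable_on_comparison_test)
      (auto simp: norm_mult intro!: mult_right_mono norm_bounded)
  then have h: "(\<lambda>(n, k). ?h n k) summable_on UNIV"
    by (rule Infinite_Sum.abs_summable_summable)
  have bij_add: "bij_betw (\<lambda>n. n + k) UNIV (UNIV :: int set)" for k
    by (rule bij_betw_byWitness[where f' = "\<lambda>n. n - k"]) auto
  have "bij_betw (\<lambda>(n, k). (n + k, k)) UNIV (UNIV :: (int \<times> int) set)"
    by (rule bij_betw_byWitness[where f' = "\<lambda>(n, k). (n - k, k)"]) auto
  with h have h': "(\<lambda>(n, k). ?h (n + k) k) summable_on UNIV"
    by (subst (asm) summable_on_reindex_bij_betw[symmetric]) (auto simp: case_prod_unfold)
  \<comment> \<open>Fubini is applied twice: with \<open>n\<close> innermost, translation by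
    \<open>k\<close> removes the difference in \<open>b (n - k)\<close>; swapping back leaves
    \<open>b n\<close> as a common factor.\<close>
  have "pairing x (convolution a b) = (\<Sum>\<^sub>\<infinity>n. \<Sum>\<^sub>\<infinity>k. ?h n k)"
    by (simp add: pairing_def convolution_def infsum_cmult_right')
  also have "\<dots> = (\<Sum>\<^sub>\<infinity>k. \<Sum>\<^sub>\<infinity>n. ?h n k)"
    using h by (intro infsum_swap_banach) simp
  also have "\<dots> = (\<Sum>\<^sub>\<infinity>k. \<Sum>\<^sub>\<infinity>n. ?h (n + k) k)"
    by (subst infsum_reindex_bij_betw[OF bij_add]) simp
  also have "\<dots> = (\<Sum>\<^sub>\<infinity>n. \<Sum>\<^sub>\<infinity>k. ?h (n + k) k)"
    using h' by (intro infsum_swap_banach[symmetric]) simp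
  also have "\<dots> = pairing (infsum ?g UNIV) b"
    unfolding pairing_def y infsum_cmult_left'[symmetric] by (simp add: mult_ac)
  finally show "pairing x (convolution a b) = pairing (infsum ?g UNIV) b" .
qed

text \<open>Convolution by \<open>a\<close> pulls the subbasic set of \<open>x\<close> back to the
  one of its adjoint image \<open>y\<close>. Commutativity covers the other variable.\<close>

lemma separately_continuous_convolution_weak_star:
  assumes "closed F" and "linf.subspace F" and "\<And>m y. y \<in> F \<Longrightarrow> shift_linf m y \<in> F"
  shows "separately_continuous_convolution (weak_star_topology F)"
proof -
  let ?T = "weak_star_topology F"
  have "F \<noteq> {}"
    using linf.subspace_0[OF assms(2)] by blast
  then have top: "topspace ?T = ell1"
    by (rule topspace_weak_star_topology)
  have "continuous_map ?T ?T (convolution a)" if a: "a \<in> ell1" for a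
    unfolding weak_star_topology_def[of F]
  proof (rule continuous_on_generated_topo, unfold weak_star_topology_def[of F, symmetric])
    fix V assume "V \<in> {{a \<in> ell1. pairing x a \<in> U} |x U. x \<in> F \<and> open U}"
    then obtain x U where V: "V = {a \<in> ell1. pairing x a \<in> U}" and "x \<in> F" "open U"
      by blast
    obtain y where "y \<in> F" and y: "\<And>b. b \<in> ell1 \<Longrightarrow> pairing x (convolution a b) = pairing y b"
      using pairing_convolution[OF assms a \<open>x \<in> F\<close>] by blast
    have "convolution a -` V \<inter> topspace ?T = {b \<in> topspace ?T. pairing y b \<in> U}"
      by (auto simp: V top y convolution_in_ell1[OF a])
    then show "openin ?T (convolution a -` V \<inter> topspace ?T)"
      using continuous_map_weak_star_topology[OF \<open>y \<in> F\<close>] \<open>open U\<close>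
      by (simp add: continuous_map_def)
  next
    have "\<Union>{{a \<in> ell1. pairing x a \<in> U} |x U. x \<in> F \<and> open U} = topspace ?T"
      by (simp add: weak_star_topology_def)
    then show "convolution a ` topspace ?T
        \<subseteq> \<Union>{{a \<in> ell1. pairing x a \<in> U} |x U. x \<in> F \<and> open U}"
      using convolution_in_ell1[OF a] by (auto simp only: top)
  qed
  then show ?thesis
    by (simp add: separately_continuous_convolution_def convolution_commute[of _ a for a])
qed


section \<open>Limits of point masses\<close>

definition point_mass :: "complex \<Rightarrow> int \<Rightarrow> int \<Rightarrow> complex" where
  "point_mass c k = (\<lambda>n. if n = k then c else 0)"

lemma point_mass_in_ell1: "point_mass c k \<in> ell1"
proof -
  have "((\<lambda>n. norm (point_mass c k n)) has_sum norm c) UNIV"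
    by (rule has_sum_finite_neutralI[where B = "{k}"]) (auto simp: point_mass_def)
  then show ?thesis
    by (auto simp: ell1_def summable_on_def)
qed

lemma pairing_point_mass: "pairing x (point_mass c k) = x k * c"
  unfolding pairing_def
  by (intro infsumI has_sum_finite_neutralI[where B = "{k}"]) (auto simp: point_mass_def)

text \<open>Sets that eventually contain \<open>s n\<close> whenever they contain \<open>a\<close>
  include the subbasic ones and are stable under binary intersections and arbitrary unions, so
  induction over the generation of open sets applies.\<close>

lemma limitin_weak_star_topology:
  assumes "F \<noteq> {}" and "a \<in> ell1" and s: "\<And>n. s n \<in> ell1"
    and lim: "\<And>x. x \<in> F \<Longrightarrow> ((\<lambda>n. pairing x (s n)) \<longlongrightarrow> pairing x a) A"
  shows "limitin (weak_star_topology F) s a A"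
proof -
  have "a \<in> V \<Longrightarrow> eventually (\<lambda>n. s n \<in> V) A"
    if "generate_topology_on {{a \<in> ell1. pairing x a \<in> U} | x U. x \<in> F \<and> open U} V" for V
    using that
  proof induction
    case (Int V W)
    then show ?case by (auto elim: eventually_elim2)
  next
    case (UN K)
    from \<open>a \<in> \<Union>K\<close> obtain X where "X \<in> K" "a \<in> X"
      by blast
    then show ?case
      using UN.IH[of X] by (auto elim: eventually_mono)
  next
    case (Basis V)
    then obtain x U where "V = {a \<in> ell1. pairing x a \<in> U}" "x \<in> F" "open U"
      by blast
    with Basis lim[of x] s show ?case
      by (auto dest: topological_tendstoD)
  qed simp
  then show ?thesis
    using assms(2) topspace_weak_star_topology[OF assms(1)]
    by (auto simp: limitin_def weak_star_topology_def openin_topology_generated_by_iff)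
qed

lemma tendsto_pairing:
  assumes "limitin (weak_star_topology F) s a A" and "x \<in> F"
  shows "((\<lambda>n. pairing x (s n)) \<longlongrightarrow> pairing x a) A"
  using continuous_map_limit[OF continuous_map_weak_star_topology[OF assms(2)] assms(1)]
  by (simp add: o_def)

text \<open>Together with \<open>closed_pointwise_limit\<close>, this carries a limit relation from
  generators to their closed complex span.\<close>

lemma subspace_pointwise_limit:
  "linf.subspace {x :: linf. ((\<lambda>n. x (s n)) \<longlongrightarrow> x k * c) A}"
proof (rule linf.subspaceI)
  fix x y :: linf
  assume "x \<in> {x :: linf. ((\<lambda>n. x (s n)) \<longlongrightarrow> x k * c) A}" "y \<in> {x :: linf. ((\<lambda>n. x (s n)) \<longlongrightarrow> x k * c) A}"
  then show "x + y \<in> {x :: linf. ((\<lambda>n. x (s n)) \<longlongrightarrow> x k * c) A}"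
    by (auto simp: distrib_right intro: tendsto_add)
next
  fix d and x :: linf
  assume "x \<in> {x :: linf. ((\<lambda>n. x (s n)) \<longlongrightarrow> x k * c) A}"
  then show "scaleC_linf d x \<in> {x :: linf. ((\<lambda>n. x (s n)) \<longlongrightarrow> x k * c) A}"
    by (auto simp: scaleC_linf.rep_eq mult.assoc intro: tendsto_mult_left)
qed simp

lemma closed_pointwise_limit:
  "closed {x :: linf. ((\<lambda>n. x (s n)) \<longlongrightarrow> x k * c) A}" (is "closed ?L")
proof -
  have "((\<lambda>n. x (s n)) \<longlongrightarrow> x k * c) A" if "x \<in> closure ?L" for x :: linf
  proof (rule tendstoI)
    fix e :: real assume "e > 0"
    \<comment> \<open>Two errors of size \<open>d\<close> occur, at \<open>s n\<close> and in the
      limit for \<open>y\<close>, and one of size \<open>d * norm c\<close> at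
      \<open>k\<close>.\<close>
    define d where "d = e / (2 + norm c)"
    have pos: "2 + norm c > 0"
      by (simp add: add_pos_nonneg)
    then have "d > 0"
      using \<open>e > 0\<close> by (simp add: d_def)
    have "d * (2 + norm c) = e"
      using pos by (simp add: d_def)
    then have d: "d + d + d * norm c = e"
      by (simp add: algebra_simps)
    from that \<open>d > 0\<close> have "\<exists>y\<in>?L. dist y x < d"
      unfolding closure_approachable by (elim allE impE)
    then obtain y where y: "y \<in> ?L" "dist y x < d"
      by (elim bexE)
    have close: "norm (y i - x i) \<le> d" for i
      using dist_bounded[of y i x] y(2) by (simp add: dist_norm)
    have "eventually (\<lambda>n. dist (y (s n)) (y k * c) < d) A"
      using y(1) \<open>d > 0\<close> by (simp add: tendstoD)
    then show "eventually (\<lambda>n. dist (x (s n)) (x k * c) < e) A"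
    proof eventually_elim
      case (elim n)
      have "x (s n) - x k * c = - (y (s n) - x (s n)) + (y (s n) - y k * c) + (y k - x k) * c"
        by (simp add: algebra_simps)
      also have "norm \<dots> \<le> norm (y (s n) - x (s n)) + norm (y (s n) - y k * c)
          + norm (y k - x k) * norm c"
        by (intro norm_triangle_mono) (simp_all add: norm_mult norm_minus_commute)
      also have "\<dots> < d + d + d * norm c"
        using elim close[of "s n"] mult_right_mono[OF close[of k] norm_ge_zero[of c]]
        by (simp add: dist_norm)
      finally show ?case
        unfolding dist_norm d .
    qed
  qed
  then show ?thesis
    by (intro closure_subset_eq[THEN iffD1]) blast
qed

section \<open>Binary digits of numbers near powers of two\<close>

lemma less_power_of_bit:
  assumes "bit (n :: nat) i"
  shows "2 ^ i \<le> n"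
  using assms by (metis bit_iff_odd div_less even_zero not_le)

lemma finite_bits: "finite {i. bit (n :: nat) i}"
proof (rule finite_subset)
  show "{i. bit n i} \<subseteq> {..n}"
  proof
    fix i assume "i \<in> {i. bit n i}"
    then have "2 ^ i \<le> n"
      using less_power_of_bit by simp
    then have "i \<le> n"
      using less_exp[of i] by linarith
    then show "i \<in> {..n}"
      by simp
  qed
qed simp

text \<open>Bit \<open>n\<close> of \<open>k\<close> is clear, so adding \<open>2 ^ n\<close> sets
  it without a carry.\<close>

lemma binary_ones_power_add:
  assumes "k < 2 ^ n"
  shows "binary_ones (2 ^ n + k) = Suc (binary_ones k)"
proof -
  have "\<not> bit k n"
    using assms less_power_of_bit by fastforce
  then have "2 ^ n + k = set_bit n k"
    by (simp add: set_bit_eq)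
  then have "{i. bit (2 ^ n + k) i} = insert n {i. bit k i}"
    by (auto simp: bit_set_bit_iff)
  with \<open>\<not> bit k n\<close> show ?thesis
    by (simp add: binary_ones_def finite_bits)
qed

text \<open>Dividing \<open>2 ^ n - m\<close> by \<open>2 ^ i\<close> leaves the remainder
  \<open>2 ^ i - m\<close> and the quotient \<open>2 ^ (n - i) - 1\<close>, which is odd.\<close>

lemma bit_power_diff:
  assumes "0 < m" "m \<le> 2 ^ i" "i < n"
  shows "bit (2 ^ n - m :: nat) i"
proof -
  obtain j where n: "n = i + Suc j"
    using \<open>i < n\<close> less_iff_Suc_add by auto
  have "(2::nat) ^ n = (2 ^ Suc j - 1) * 2 ^ i + 2 ^ i"
    by (simp add: n power_add algebra_simps)
  then have *: "2 ^ n - m = (2 ^ i - m) + (2 ^ Suc j - 1) * 2 ^ i"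
    using assms by linarith
  have "(2 ^ n - m) div 2 ^ i = 2 ^ Suc j - 1"
    unfolding * using assms by (subst div_mult_self1) simp_all
  then show ?thesis
    by (simp add: bit_iff_odd)
qed

text \<open>All bits from \<open>j\<close> up to \<open>n - 1\<close> are set.\<close>

lemma binary_ones_power_diff:
  assumes "0 < m" "m \<le> 2 ^ j"
  shows "n - j \<le> binary_ones (2 ^ n - m)"
proof -
  have "{j..<n} \<subseteq> {i. bit (2 ^ n - m) i}"
  proof
    fix i assume "i \<in> {j..<n}"
    then have "m \<le> 2 ^ i"
      using assms(2) power_increasing[of j i "2::nat"]
      by (auto intro: order_trans)
    with \<open>i \<in> {j..<n}\<close> show "i \<in> {i. bit (2 ^ n - m) i}"
      using bit_power_diff[OF assms(1)] by simp
  qed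
  from card_mono[OF finite_bits this] show ?thesis
    by (simp add: binary_ones_def)
qed

section \<open>Limits along powers of two\<close>

lemma x0_at_zero:
  assumes "norm l > 1"
  shows "x0 l 0 = 1"
  using assms by (simp add: apply_x0 binary_ones_def)

text \<open>For \<open>m \<le> 0\<close> the sequence is eventually constant; for
  \<open>m > 0\<close> it tends to 0, which is the claimed limit because \<open>x0 l\<close>
  vanishes at \<open>- m\<close>.\<close>

lemma tendsto_x0:
  assumes "norm l > 1"
  shows "(\<lambda>n. x0 l (2 ^ n - m)) \<longlonglongrightarrow> x0 l (- m) * inverse l"
proof (cases "m \<le> 0")
  case True
  define k where "k = nat (- m)"
  then have m: "m = - int k"
    using True by simp
  have "eventually (\<lambda>n. x0 l (2 ^ n - m) = x0 l (- m) * inverse l) sequentially"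
    using eventually_ge_at_top[of k]
  proof eventually_elim
    case (elim n)
    have "k < 2 ^ n"
      using elim less_exp[of n] by linarith
    moreover have "nat (2 ^ n + int k) = 2 ^ n + k"
      by (simp add: nat_add_distrib nat_power_eq)
    ultimately show ?case
      using assms by (simp add: m apply_x0 binary_ones_power_add power_int_minus
          del: of_nat_Suc)
  qed
  then show ?thesis
    by (rule tendsto_eventually)
next
  case False
  define k where "k = nat m"
  then have m: "m = int k" and "0 < k"
    using False by simp_all
  have bound: "norm (x0 l (2 ^ n - m)) \<le> inverse (norm l) ^ (n - k)" for n
  proof (cases "k \<le> 2 ^ n")
    case True
    have "2 ^ n - m = int (2 ^ n - k)"
      using True by (simp add: m of_nat_diff)
    then have "norm (x0 l (2 ^ n - m)) = inverse (norm l) ^ binary_ones (2 ^ n - k)"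
      using assms by (simp add: apply_x0 power_int_minus norm_inverse norm_power power_inverse)
    also have "\<dots> \<le> inverse (norm l) ^ (n - k)"
    proof (rule power_decreasing)
      show "n - k \<le> binary_ones (2 ^ n - k)"
        \<comment> \<open>The exponent \<open>j = k\<close> is admissible since
          \<open>k < 2 ^ k\<close>.\<close>
        using \<open>0 < k\<close> less_exp[of k] by (intro binary_ones_power_diff) simp_all
    qed (use assms in \<open>auto simp: inverse_le_1_iff\<close>)
    finally show ?thesis .
  next
    case False
    \<comment> \<open>The argument \<open>2 ^ n - m\<close> is negative here, so the value is
      0.\<close>
    then have "(2::int) ^ n < m"
      unfolding m not_le by (metis of_nat_less_iff of_nat_numeral of_nat_power)
    then show ?thesis
      using assms by (simp add: apply_x0)
  qed
  have "(\<lambda>n. inverse (norm l) ^ n) \<longlonglongrightarrow> 0"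
    using assms by (intro LIMSEQ_power_zero) (simp add: inverse_less_1_iff)
  \<comment> \<open>Moving the index by \<open>k\<close> undoes the truncated subtraction.\<close>
  then have "(\<lambda>n. inverse (norm l) ^ (n - k)) \<longlonglongrightarrow> 0"
    by (intro LIMSEQ_offset[of "\<lambda>n. inverse (norm l) ^ (n - k)" k]) simp
  then have "(\<lambda>n. x0 l (2 ^ n - m)) \<longlonglongrightarrow> 0"
    by (rule Lim_null_comparison[OF always_eventually, rotated]) (use bound in blast)
  then show ?thesis
    using False assms by (simp add: apply_x0)
qed

lemma tendsto_F_predual:
  assumes "norm l > 1" and "x \<in> F_predual l"
  shows "(\<lambda>n. x (2 ^ n)) \<longlonglongrightarrow> x 0 * inverse l"
proof -
  let ?L = "{x :: linf. (\<lambda>n. x (2 ^ n)) \<longlonglongrightarrow> x 0 * inverse l}"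
  have "range (\<lambda>m. shift_linf m (x0 l)) \<subseteq> ?L"
    using tendsto_x0[OF assms(1)] by (auto simp: shift_linf.rep_eq)
  then have "F_predual l \<subseteq> ?L"
    unfolding F_predual_def
    by (intro closure_minimal linf.span_minimal subspace_pointwise_limit closed_pointwise_limit)
  with assms(2) show ?thesis
    by blast
qed

lemma limitin_F_predual:
  assumes "norm l > 1"
  shows "limitin (weak_star_topology (F_predual l)) (\<lambda>n. point_mass 1 (2 ^ n))
    (point_mass (inverse l) 0) sequentially"
  using tendsto_F_predual[OF assms] x0_in_F_predual
  by (intro limitin_weak_star_topology) (auto simp: pairing_point_mass point_mass_in_ell1)

lemma limitin_c0:
  "limitin (weak_star_topology c0) (\<lambda>n. point_mass 1 (2 ^ n)) (point_mass 0 0) sequentially"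
proof (rule limitin_weak_star_topology)
  have "0 \<in> c0"
    by (simp add: c0_def)
  then show "c0 \<noteq> {}"
    by blast
  have "filterlim (\<lambda>n. 2 ^ n :: int) cofinite sequentially"
    \<comment> \<open>With both filters cofinite, the claim is that preimages of finite sets are
      finite, which follows from injectivity of \<open>2 ^ n\<close>.\<close>
    unfolding cofinite_eq_sequentially[symmetric] filterlim_iff eventually_cofinite
  proof (intro allI impI)
    fix P :: "int \<Rightarrow> bool"
    assume "finite {k. \<not> P k}"
    from finite_vimageI[OF this, of "\<lambda>n::nat. 2 ^ n"] show "finite {n::nat. \<not> P (2 ^ n)}"
      by (simp add: vimage_def inj_on_def)
  qed
  then show "(\<lambda>n. pairing x (point_mass 1 (2 ^ n))) \<longlonglongrightarrow> pairing x (point_mass 0 0)"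
    if "x \<in> c0" for x
    using that by (auto simp: pairing_point_mass c0_def intro: filterlim_compose)
qed (rule point_mass_in_ell1)+

text \<open>Testing against \<open>x0 l\<close> alone, whose value at 0 is 1, reads off
  \<open>c\<close>; uniqueness is that of limits of complex sequences.\<close>

lemma limit_determines_parameter:
  assumes "norm l > 1"
    and "limitin (weak_star_topology (F_predual l)) (\<lambda>n. point_mass 1 (2 ^ n))
      (point_mass c 0) sequentially"
  shows "c = inverse l"
proof -
  have "(\<lambda>n. x0 l (2 ^ n)) \<longlonglongrightarrow> c"
    using tendsto_pairing[OF assms(2) x0_in_F_predual]
    by (simp add: pairing_point_mass x0_at_zero[OF assms(1)])
  moreover have "(\<lambda>n. x0 l (2 ^ n)) \<longlonglongrightarrow> inverse l"
    using tendsto_F_predual[OF assms(1) x0_in_F_predual] by (simp add: x0_at_zero[OF assms(1)])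
  ultimately show ?thesis
    by (rule LIMSEQ_unique)
qed

section \<open>Distinctness and number of the topologies\<close>

lemma inj_on_weak_star_topology_F_predual:
  "inj_on (\<lambda>l. weak_star_topology (F_predual l)) {l. norm l > 1}"
proof (rule inj_onI)
  fix l k :: complex
  assume "l \<in> {l. norm l > 1}" "k \<in> {l. norm l > 1}"
    and "weak_star_topology (F_predual l) = weak_star_topology (F_predual k)"
  then have "inverse k = inverse l"
    using limit_determines_parameter[of l] limitin_F_predual[of k] by simp
  then show "l = k"
    by simp
qed

text \<open>Real and imaginary parts embed the set into the real plane, which is equipollent to the
  line; conversely it contains the real interval from 1 to 2.\<close>

lemma eqpoll_outside_disc: "{l :: complex. norm l > 1} \<approx> (UNIV :: real set)"
proof (rule lepoll_antisym)
  have "inj_on (\<lambda>z. (Re z, Im z)) {l. norm l > 1}"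
    by (auto intro!: inj_onI complex_eqI)
  then have "{l :: complex. norm l > 1} \<lesssim> (UNIV :: real set) \<times> (UNIV :: real set)"
    unfolding lepoll_def by blast
  also have "\<dots> \<approx> (UNIV :: real set)"
    unfolding eqpoll_iff_card_of_ordIso
    by (intro card_of_Times_same_infinite) (rule infinite_UNIV_char_0)
  finally show "{l :: complex. norm l > 1} \<lesssim> (UNIV :: real set)" .
next
  have "(UNIV :: real set) \<approx> {1<..<2::real}"
    by (simp add: open_interval_eqpoll_reals eqpoll_sym)
  also have "{1<..<2::real} \<lesssim> {l :: complex. norm l > 1}"
    unfolding lepoll_def by (rule exI[of _ of_real]) (auto intro: inj_onI)
  finally show "(UNIV :: real set) \<lesssim> {l :: complex. norm l > 1}" .
qed

theorem corollary3p5: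
  shows "inj_on (\<lambda>l. weak_star_topology (F_predual l)) {l :: complex. norm l > 1} \<and>
    (\<lambda>l. weak_star_topology (F_predual l)) ` {l :: complex. norm l > 1} \<approx> (UNIV :: real set) \<and>
    (\<forall>l :: complex. norm l > 1 \<longrightarrow>
       separately_continuous_convolution (weak_star_topology (F_predual l)) \<and>
       weak_star_topology (F_predual l) \<noteq> weak_star_topology c0)"
proof (intro conjI allI impI)
  show "inj_on (\<lambda>l. weak_star_topology (F_predual l)) {l :: complex. norm l > 1}"
    by (rule inj_on_weak_star_topology_F_predual)
  then show "(\<lambda>l. weak_star_topology (F_predual l)) ` {l :: complex. norm l > 1} \<approx> (UNIV :: real set)"
    by (rule eqpoll_trans[OF inj_on_image_eqpoll_self eqpoll_outside_disc])
next
  fix l :: complex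
  assume l: "norm l > 1"
  show "separately_continuous_convolution (weak_star_topology (F_predual l))"
    by (intro separately_continuous_convolution_weak_star closed_F_predual subspace_F_predual
        shift_linf_F_predual)
  show "weak_star_topology (F_predual l) \<noteq> weak_star_topology c0"
  proof
    assume "weak_star_topology (F_predual l) = weak_star_topology c0"
    \<comment> \<open>The limit for \<open>c0\<close> was written as \<open>point_mass 0 0\<close>,
      so the parameter lemma applies with \<open>c = 0\<close>.\<close>
    then have "0 = inverse l"
      using limit_determines_parameter[OF l] limitin_c0 by simp
    with l show False
      by auto
  qed
qed

end
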